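(* Any semi-clairvoyant algorithm is $\Omega(\ln^{1-1/\alpha}P)$-competitive with respect to makespan plus energy: there is a constant $c>0$ depending only on $\alpha$ such that for every $P\ge2$ and every semi-clairvoyant algorithm $A$ on $P$ processors, there exists a job set $\mathcal{J}$ with $H_A(\mathcal{J})\ge c(\ln P)^{1-1/\alpha}H^*(\mathcal{J})$.
   Context: Model: there are $P$ processors whose speeds can be set individually at every time; a processor running at speed $s\ge 0$ consumes power $s^\alpha$, where $\alpha>1$ is a fixed constant. A job set $\mathcal{J}=\{J_1,\dots,J_n\}$: each job $J_i$ has a release time $r_i\ge0$ and a sequence of phases executed in order; phase $J_i^k$ has work $w_i^k>0$ and parallelism $h_i^k\in[1,\infty]$. If at time $t$ job $J_i$ is in phase $k$ and is allocated $a_i(t)$ processors with speeds $s_1\ge\dots\ge s_{a_i(t)}$, its execution rate is $\sum_{j=1}^{\min\{a_i(t),h_i^k\}}s_j$. A valid schedule uses disjoint processor sets with $\sum_i a_i(t)\le P$, unallocated processors have speed $0$, no job runs before its release, phases run in order, and each job completes at finite time $c_i$. Makespan $M=\max_i c_i$, energy $E=\int_0^\infty u_t\,dt$ with $u_t$ the total power at time $t$, $H=M+E$; $H_A$ is its value under algorithm $A$ and $H^*$ the minimum over all valid schedules. An algorithm is semi-clairvoyant if it knows the current (instantaneous) parallelism of each active job but no future information such as future parallelism or remaining work. *)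

theory Defs
  imports "HOL-Analysis.Analysis"
begin

record phase =
  work :: real
  par :: ereal

record job =
  release :: real
  phases :: "phase list"

type_synonym jobset = "job list"

definition valid_jobset :: "jobset \<Rightarrow> bool" where
  "valid_jobset J \<longleftrightarrow> J \<noteq> [] \<and>
     (\<forall>jb \<in> set J. 0 \<le> release jb \<and> phases jb \<noteq> [] \<and>
        (\<forall>ph \<in> set (phases jb). 0 < work ph \<and> 1 \<le> par ph))"

text \<open>
  Processors are the numbers below \<open>P\<close>; jobs are positions in the job list. At every time each
  processor serves at most one job, so the processor sets of distinct jobs are disjoint and their
  sizes add up to at most \<open>P\<close>. Values at negative times or for processors \<open>\<ge> P\<close> are never used.
\<close>

record schedule =
  alloc :: "real \<Rightarrow> nat \<Rightarrow> nat option"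
  speed :: "real \<Rightarrow> nat \<Rightarrow> real"

definition job_speeds :: "nat \<Rightarrow> schedule \<Rightarrow> nat \<Rightarrow> real \<Rightarrow> real list" where
  "job_speeds P S i t = rev (sort (map (speed S t) (filter (\<lambda>p. alloc S t p = Some i) [0..<P])))"

definition exec_rate :: "nat \<Rightarrow> schedule \<Rightarrow> nat \<Rightarrow> ereal \<Rightarrow> real \<Rightarrow> real" where
  "exec_rate P S i h t =
     (\<Sum>j | 1 \<le> j \<and> ereal (real j) \<le> min (ereal (real (length (job_speeds P S i t)))) h.
        job_speeds P S i t ! (j - 1))"

text \<open>
  The time at which phase \<open>k\<close> (counted from 0) of job \<open>i\<close> begins, and hence phase \<open>k - 1\<close> ends;
  it is \<open>\<infinity>\<close> if this never happens. For \<open>k = length (phases jb)\<close> it is the completion time.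
\<close>

primrec phase_start :: "nat \<Rightarrow> schedule \<Rightarrow> nat \<Rightarrow> job \<Rightarrow> nat \<Rightarrow> ereal" where
  "phase_start P S i jb 0 = ereal (release jb)"
| "phase_start P S i jb (Suc k) =
     Inf {ereal t | t. phase_start P S i jb k \<le> ereal t \<and>
       ennreal (work (phases jb ! k)) \<le>
         (\<integral>\<^sup>+\<tau>\<in>{\<tau>. phase_start P S i jb k \<le> ereal \<tau> \<and> \<tau> \<le> t}.
            ennreal (exec_rate P S i (par (phases jb ! k)) \<tau>) \<partial>lborel)}"

definition completion :: "nat \<Rightarrow> jobset \<Rightarrow> schedule \<Rightarrow> nat \<Rightarrow> ereal" where
  "completion P J S i = phase_start P S i (J ! i) (length (phases (J ! i)))"

text \<open>
  The measurability and local integrability conditions only make the executed work a well-defined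
  finite quantity on bounded time intervals; a speed profile that is not locally integrable would
  have infinite energy anyway.
\<close>

definition valid_schedule :: "nat \<Rightarrow> jobset \<Rightarrow> schedule \<Rightarrow> bool" where
  "valid_schedule P J S \<longleftrightarrow>
     (\<forall>t\<ge>0. \<forall>p<P. 0 \<le> speed S t p) \<and>
     (\<forall>t\<ge>0. \<forall>p<P. alloc S t p = None \<longrightarrow> speed S t p = 0) \<and>
     (\<forall>t\<ge>0. \<forall>p<P. \<forall>i. alloc S t p = Some i \<longrightarrow> i < length J \<and> release (J ! i) \<le> t) \<and>
     (\<forall>p<P. \<forall>i. {t. 0 \<le> t \<and> alloc S t p = Some i} \<in> sets borel) \<and>
     (\<forall>p<P. \<forall>T. set_integrable lborel {0..T} (\<lambda>t. speed S t p)) \<and>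
     (\<forall>i<length J. completion P J S i < \<infinity>)"

definition makespan :: "nat \<Rightarrow> jobset \<Rightarrow> schedule \<Rightarrow> real" where
  "makespan P J S = Max ((\<lambda>i. real_of_ereal (completion P J S i)) ` {..<length J})"

definition energy :: "real \<Rightarrow> nat \<Rightarrow> schedule \<Rightarrow> ennreal" where
  "energy \<alpha> P S = (\<integral>\<^sup>+t\<in>{0..}. ennreal (\<Sum>p<P. speed S t p powr \<alpha>) \<partial>lborel)"

definition cost :: "real \<Rightarrow> nat \<Rightarrow> jobset \<Rightarrow> schedule \<Rightarrow> ennreal" where
  "cost \<alpha> P J S = ennreal (makespan P J S) + energy \<alpha> P S"

definition opt_cost :: "real \<Rightarrow> nat \<Rightarrow> jobset \<Rightarrow> ennreal" where
  "opt_cost \<alpha> P J = (INF S \<in> {S. valid_schedule P J S}. cost \<alpha> P J S)"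

text \<open>
  What a semi-clairvoyant algorithm sees at time \<open>t\<close>: the jobs that are active (released and not yet
  completed), each with the parallelism of its current phase.
\<close>

definition visible :: "nat \<Rightarrow> jobset \<Rightarrow> schedule \<Rightarrow> real \<Rightarrow> (nat \<times> ereal) set" where
  "visible P J S t =
     {(i, par (phases (J ! i) ! k)) | i k. i < length J \<and> k < length (phases (J ! i)) \<and>
        phase_start P S i (J ! i) k \<le> ereal t \<and> ereal t < phase_start P S i (J ! i) (Suc k)}"

text \<open>
  A (deterministic) algorithm maps every job set to a valid schedule. It is semi-clairvoyant if its
  decision at time \<open>t\<close> depends only on what it has seen up to and including time \<open>t\<close>. Its own past
  decisions, and thus the work executed so far, are themselves determined by these observations.
\<close>

definition semi_clairvoyant :: "nat \<Rightarrow> (jobset \<Rightarrow> schedule) \<Rightarrow> bool" where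
  "semi_clairvoyant P A \<longleftrightarrow>
     (\<forall>J. valid_jobset J \<longrightarrow> valid_schedule P J (A J)) \<and>
     (\<forall>J J' t. valid_jobset J \<longrightarrow> valid_jobset J' \<longrightarrow> 0 \<le> t \<longrightarrow>
        (\<forall>\<tau>\<in>{0..t}. visible P J (A J) \<tau> = visible P J' (A J') \<tau>) \<longrightarrow>
        (\<forall>p<P. alloc (A J) t p = alloc (A J') t p \<and> speed (A J) t p = speed (A J') t p))"

end

theory Submission imports Defs begin

text \<open>
  The adversary releases \<open>P\<close> sequential jobs at time 0, with works \<open>n powr (-1 / \<alpha>)\<close> for
  \<open>n = 1, \<dots>, P\<close>. An algorithm sees only which jobs are active, so the adversary can decide the works
  on-line: while \<open>n\<close> jobs are active, the first of them to progress to \<open>n powr (-1 / \<alpha>)\<close> is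
  completed. Hence, whenever \<open>n\<close> jobs are active, their progresses \<open>x\<^sub>j\<close> satisfy \<open>n * x\<^sub>j powr \<alpha> \<le> 1\<close>.
  If \<open>r\<^sub>j\<close> are the execution rates, then \<open>r * b powr (\<alpha> - 1) \<le> r powr \<alpha> + b powr \<alpha>\<close>, summed over the
  active jobs whose progress exceeds half of their work, with \<open>b = w\<^sub>j / 2 \<le> x\<^sub>j\<close>, is at most
  the total power plus 1. Integrating over time, makespan plus energy is at least
  \<open>\<Sum>j. (w\<^sub>j / 2) powr \<alpha> = (1 / 2) powr \<alpha> * H\<close>, where \<open>H\<close> is the \<open>P\<close>-th harmonic number.
  Knowing the works, one can instead run job \<open>j\<close> at speed \<open>w\<^sub>j / T\<close> with \<open>T = H powr (1 / \<alpha>)\<close>, so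
  that all jobs complete at \<open>T\<close>, at total cost \<open>2 * T\<close>.
\<close>

section \<open>Sequential phases\<close>

text \<open>With parallelism 1 only the index \<open>j = 1\<close> contributes, so the rate is the
  head of the descending speed list: the largest speed among the processors serving the job.\<close>

lemma exec_rate_seq_eq_Max:
  "exec_rate P S i 1 t =
    (let Q = {p. p < P \<and> alloc S t p = Some i} in if Q = {} then 0 else Max (speed S t ` Q))"
proof -
  define ys where "ys = sort (map (speed S t) (filter (\<lambda>p. alloc S t p = Some i) [0..<P]))"
  have js: "job_speeds P S i t = rev ys"
    by (simp add: job_speeds_def ys_def)
  have set_ys: "set ys = speed S t ` {p. p < P \<and> alloc S t p = Some i}"
    by (auto simp: ys_def)
  show ?thesis
  proof (cases "ys = []")
    case True
    then have none: "{j. 1 \<le> j \<and> ereal (real j) \<le> min (ereal (real (length (rev ys)))) 1} = {}"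
      by (auto simp: one_ereal_def)
    from True set_ys have "{p. p < P \<and> alloc S t p = Some i} = {}" by auto
    then show ?thesis by (simp only: exec_rate_def js none Let_def) auto
  next
    case False
    then have len: "length ys \<ge> 1" by (cases ys) auto
    have one: "{j. 1 \<le> j \<and> ereal (real j) \<le> min (ereal (real (length (rev ys)))) 1} = {1::nat}"
      using len by (auto simp: one_ereal_def)
    have "exec_rate P S i 1 t = ys ! (length ys - 1)"
      using len by (simp only: exec_rate_def js one) (simp add: rev_nth Suc_le_eq)
    also have "\<dots> = Max (set ys)"
    proof (rule Max_eqI [symmetric])
      fix y assume "y \<in> set ys"
      then obtain k where "k < length ys" "y = ys ! k" by (auto simp: in_set_conv_nth)
      then show "y \<le> ys ! (length ys - 1)"
        by (auto simp: ys_def intro!: sorted_nth_mono)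
    qed (use len in auto)
    finally have "exec_rate P S i 1 t = Max (speed S t ` {p. p < P \<and> alloc S t p = Some i})"
      by (simp only: set_ys)
    moreover have "{p. p < P \<and> alloc S t p = Some i} \<noteq> {}"
      using False set_ys by fastforce
    ultimately show ?thesis by (simp only: Let_def if_False)
  qed
qed

lemma exec_rate_seq_attained:
  assumes "exec_rate P S i 1 t \<noteq> 0"
  obtains p where "p < P" "alloc S t p = Some i" "exec_rate P S i 1 t = speed S t p"
proof -
  define Q where "Q = {p. p < P \<and> alloc S t p = Some i}"
  have "Q \<noteq> {}" and eq: "exec_rate P S i 1 t = Max (speed S t ` Q)"
    using assms by (auto simp: exec_rate_seq_eq_Max Let_def Q_def split: if_splits)
  then have "Max (speed S t ` Q) \<in> speed S t ` Q"
    by (intro Max_in) (auto simp: Q_def)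
  then show ?thesis using that eq by (auto simp: Q_def)
qed

lemma exec_rate_seq_nonneg:
  assumes "\<And>p. p < P \<Longrightarrow> 0 \<le> speed S t p"
  shows "0 \<le> exec_rate P S i 1 t"
  by (metis exec_rate_seq_attained assms order_refl)

text \<open>Here the maximum ranges over an index set that does not depend on \<open>t\<close>, so
  measurability in \<open>t\<close> can be read off. Speeds are nonnegative, so padding with 0 does
  not change the maximum.\<close>

lemma exec_rate_seq_eq_Max_if:
  assumes "P > 0" and nonneg: "\<And>p. p < P \<Longrightarrow> 0 \<le> speed S t p"
  shows "exec_rate P S i 1 t =
    Max ((\<lambda>p. if alloc S t p = Some i then speed S t p else 0) ` {..<P})"
proof (rule Max_eqI [symmetric])
  let ?Q = "{p. p < P \<and> alloc S t p = Some i}"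
  show "y \<le> exec_rate P S i 1 t"
    if "y \<in> (\<lambda>p. if alloc S t p = Some i then speed S t p else 0) ` {..<P}" for y
  proof -
    from that obtain p where p: "p < P" "y = (if alloc S t p = Some i then speed S t p else 0)"
      by auto
    show ?thesis
    proof (cases "alloc S t p = Some i")
      case True
      then have "p \<in> ?Q" using p by auto
      then have "speed S t p \<le> Max (speed S t ` ?Q)" by (intro Max_ge) auto
      then show ?thesis using True p \<open>p \<in> ?Q\<close>
        by (auto simp: exec_rate_seq_eq_Max Let_def)
    next
      case False
      then show ?thesis using p exec_rate_seq_nonneg [of P S t i, OF nonneg] by auto
    qed
  qed
  show "exec_rate P S i 1 t \<in> (\<lambda>p. if alloc S t p = Some i then speed S t p else 0) ` {..<P}"
  proof (cases "?Q = {}")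
    case True
    then show ?thesis using \<open>P > 0\<close>
      by (auto simp: exec_rate_seq_eq_Max Let_def image_iff intro!: bexI [of _ 0])
  next
    case False
    then have "exec_rate P S i 1 t \<in> speed S t ` ?Q"
      using Max_in [of "speed S t ` ?Q"] by (auto simp: exec_rate_seq_eq_Max Let_def)
    then show ?thesis by (auto simp: image_iff)
  qed
qed auto

lemma exec_rate_cong:
  assumes "\<And>p. p < P \<Longrightarrow> alloc S t p = alloc S' t p \<and> speed S t p = speed S' t p"
  shows "exec_rate P S i h t = exec_rate P S' i h t"
proof -
  have "filter (\<lambda>p. alloc S t p = Some i) [0..<P] = filter (\<lambda>p. alloc S' t p = Some i) [0..<P]"
    using assms by (intro filter_cong) auto
  moreover have "map (speed S t) (filter (\<lambda>p. alloc S' t p = Some i) [0..<P]) =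
      map (speed S' t) (filter (\<lambda>p. alloc S' t p = Some i) [0..<P])"
    using assms by (intro map_cong) auto
  ultimately have "job_speeds P S i t = job_speeds P S' i t" by (simp only: job_speeds_def)
  then show ?thesis by (simp add: exec_rate_def)
qed

text \<open>A nonzero rate is the speed of one processor serving the job, and distinct jobs are
  served by disjoint processor sets; so the powers of the rates are paid for by the total
  power.\<close>

lemma sum_exec_rate_seq_powr_le:
  assumes "\<And>p. p < P \<Longrightarrow> 0 \<le> speed S t p" and "0 < \<alpha>" and "finite I"
  shows "(\<Sum>i\<in>I. exec_rate P S i 1 t powr \<alpha>) \<le> (\<Sum>p<P. speed S t p powr \<alpha>)"
proof -
  define Q where "Q i = {p. p < P \<and> alloc S t p = Some i}" for i
  have "exec_rate P S i 1 t powr \<alpha> \<le> (\<Sum>p\<in>Q i. speed S t p powr \<alpha>)" for i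
  proof (cases "exec_rate P S i 1 t = 0")
    case False
    then obtain p where "p \<in> Q i" "exec_rate P S i 1 t = speed S t p"
      by (elim exec_rate_seq_attained) (auto simp: Q_def)
    then show ?thesis using member_le_sum [of p "Q i" "\<lambda>p. speed S t p powr \<alpha>"]
      by (auto simp: Q_def)
  qed (auto intro!: sum_nonneg)
  then have "(\<Sum>i\<in>I. exec_rate P S i 1 t powr \<alpha>) \<le> (\<Sum>i\<in>I. \<Sum>p\<in>Q i. speed S t p powr \<alpha>)"
    by (intro sum_mono)
  also have "\<dots> = (\<Sum>p\<in>(\<Union>i\<in>I. Q i). speed S t p powr \<alpha>)"
    by (intro sum.UNION_disjoint [symmetric] \<open>finite I\<close>) (auto simp: Q_def)
  also have "\<dots> \<le> (\<Sum>p<P. speed S t p powr \<alpha>)"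
    by (intro sum_mono2) (auto simp: Q_def)
  finally show ?thesis .
qed

section \<open>Progress of sequential jobs\<close>

text \<open>The work a sequential job would have received by time \<open>t\<close>, regardless of
  its required work, so runs on different job sets can be compared. The Henstock-Kurzweil integral
  gives additivity and continuity; \<open>exec_rate_seq_nn_integral\<close> links it to the integral
  in \<open>phase_start\<close>.\<close>

definition progress :: "nat \<Rightarrow> schedule \<Rightarrow> nat \<Rightarrow> real \<Rightarrow> real" where
  "progress P S i t = integral {0..t} (exec_rate P S i 1)"

text \<open>The part of validity that mentions no job set. It lets progress be computed for a
  schedule whose completion times are not yet known to be finite.\<close>

definition regular_schedule :: "nat \<Rightarrow> schedule \<Rightarrow> bool" where
  "regular_schedule P S \<longleftrightarrow> P > 0 \<and>
     (\<forall>t\<ge>0. \<forall>p<P. 0 \<le> speed S t p) \<and>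
     (\<forall>p<P. \<forall>i. {t. 0 \<le> t \<and> alloc S t p = Some i} \<in> sets borel) \<and>
     (\<forall>p<P. \<forall>T. set_integrable lborel {0..T} (\<lambda>t. speed S t p))"

lemma valid_schedule_imp_regular: "valid_schedule P J S \<Longrightarrow> P > 0 \<Longrightarrow> regular_schedule P S"
  by (auto simp: valid_schedule_def regular_schedule_def)

text \<open>The rate is a maximum of finitely many measurable functions and is dominated by the sum
  of all speeds, which is integrable on bounded intervals.\<close>

lemma exec_rate_seq_set_integrable:
  assumes "regular_schedule P S"
  shows "set_integrable lborel {0..T} (exec_rate P S i 1)"
proof -
  note reg = assms [unfolded regular_schedule_def]
  let ?f = "\<lambda>p t. indicator {0..T} t * speed S t p"
  have f: "integrable lborel (?f p)" if "p < P" for p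
    using reg that by (auto simp: set_integrable_def)
  define g where "g p t = indicator {t. 0 \<le> t \<and> alloc S t p = Some i} t * ?f p t" for p t
  have g: "g p \<in> borel_measurable lborel" if "p < P" for p
    unfolding g_def
  proof (rule borel_measurable_times)
    show "?f p \<in> borel_measurable lborel"
      using f [OF that] by (rule borel_measurable_integrable)
  qed (use reg that in auto)
  have eq: "indicator {0..T} t *\<^sub>R exec_rate P S i 1 t = Max ((\<lambda>p. g p t) ` {..<P})" for t
  proof (cases "t \<in> {0..T}")
    case True
    then have "exec_rate P S i 1 t =
        Max ((\<lambda>p. if alloc S t p = Some i then speed S t p else 0) ` {..<P})"
      using reg by (intro exec_rate_seq_eq_Max_if) auto
    also have "(\<lambda>p. if alloc S t p = Some i then speed S t p else 0) = (\<lambda>p. g p t)"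
      using True by (auto simp: g_def fun_eq_iff)
    finally show ?thesis using True by simp
  next
    case False
    then have "(\<lambda>p. g p t) ` {..<P} = {0}" using reg by (auto simp: g_def image_iff)
    then show ?thesis using False by simp
  qed
  have "integrable lborel (\<lambda>t. indicator {0..T} t *\<^sub>R exec_rate P S i 1 t)"
  proof (rule Bochner_Integration.integrable_bound)
    show "integrable lborel (\<lambda>t. \<Sum>p<P. ?f p t)"
      using f by (intro Bochner_Integration.integrable_sum) auto
    show "(\<lambda>t. indicator {0..T} t *\<^sub>R exec_rate P S i 1 t) \<in> borel_measurable lborel"
      unfolding eq using g by (intro borel_measurable_Max) auto
    show "AE t in lborel. norm (indicator {0..T} t *\<^sub>R exec_rate P S i 1 t) \<le> norm (\<Sum>p<P. ?f p t)"
    proof (rule AE_I2)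
      fix t
      show "norm (indicator {0..T} t *\<^sub>R exec_rate P S i 1 t) \<le> norm (\<Sum>p<P. ?f p t)"
      proof (cases "t \<in> {0..T}")
        case True
        then have nn: "0 \<le> speed S t p" if "p < P" for p using reg that by auto
        have "exec_rate P S i 1 t \<le> (\<Sum>p<P. speed S t p)"
        proof (cases "exec_rate P S i 1 t = 0")
          case False
          then obtain p where "p < P" "exec_rate P S i 1 t = speed S t p"
            by (elim exec_rate_seq_attained)
          then show ?thesis using nn member_le_sum [of p "{..<P}" "speed S t"] by auto
        qed (auto intro!: sum_nonneg nn)
        moreover have "0 \<le> exec_rate P S i 1 t" using nn by (rule exec_rate_seq_nonneg)
        ultimately show ?thesis using True by simp
      qed simp
    qed
  qed
  then show ?thesis by (simp add: set_integrable_def)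
qed

lemma exec_rate_seq_integrable_on:
  assumes "regular_schedule P S" "0 \<le> a"
  shows "exec_rate P S i 1 integrable_on {a..b}"
proof -
  have "exec_rate P S i 1 integrable_on {0..b}"
    using exec_rate_seq_set_integrable [OF assms(1)] by (rule set_borel_integral_eq_integral)
  then show ?thesis by (rule integrable_on_subinterval) (use assms(2) in auto)
qed

lemma exec_rate_seq_integral:
  assumes "regular_schedule P S" "0 \<le> a" "a \<le> b"
  shows "integral {a..b} (exec_rate P S i 1) = progress P S i b - progress P S i a"
  using Henstock_Kurzweil_Integration.integral_combine
    [OF assms(2,3) exec_rate_seq_integrable_on [OF assms(1) order_refl, of i b]]
  by (simp add: progress_def)

lemma exec_rate_seq_nn_integral:
  assumes "regular_schedule P S" "0 \<le> a" "a \<le> b"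
  shows "(\<integral>\<^sup>+\<tau>\<in>{a..b}. ennreal (exec_rate P S i 1 \<tau>) \<partial>lborel) =
    ennreal (progress P S i b - progress P S i a)"
proof -
  have "(exec_rate P S i 1 has_integral (progress P S i b - progress P S i a)) {a..b}"
    using exec_rate_seq_integrable_on [OF assms(1,2)] exec_rate_seq_integral [OF assms]
    by (metis integrable_integral)
  then show ?thesis
    using assms by (intro nn_integral_has_integral_lebesgue')
      (auto simp: regular_schedule_def intro!: exec_rate_seq_nonneg)
qed

lemma progress_0 [simp]: "progress P S i 0 = 0"
  by (simp add: progress_def)

lemma progress_mono:
  assumes "regular_schedule P S" "0 \<le> a" "a \<le> b"
  shows "progress P S i a \<le> progress P S i b"
proof -
  have "0 \<le> integral {a..b} (exec_rate P S i 1)"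
    using assms by (intro Henstock_Kurzweil_Integration.integral_nonneg exec_rate_seq_integrable_on)
      (auto simp: regular_schedule_def intro!: exec_rate_seq_nonneg)
  then show ?thesis using exec_rate_seq_integral [OF assms, of i] by simp
qed

lemma progress_nonneg:
  assumes "regular_schedule P S" "0 \<le> t"
  shows "0 \<le> progress P S i t"
  using progress_mono [of P S 0 t i] assms by simp

text \<open>Progress is continuous, so the level set of \<open>v\<close> in \<open>{0..t}\<close> is
  compact, and nonempty by the intermediate value theorem. Its least element is the first hitting
  time, and monotonicity keeps progress below \<open>v\<close> before it.\<close>

lemma progress_first_hit:
  assumes reg: "regular_schedule P S" and "0 \<le> t" "v \<le> progress P S i t" "0 < v"
  obtains h where "0 \<le> h" "h \<le> t" "progress P S i h = v"
    "\<And>t. 0 \<le> t \<Longrightarrow> t < h \<Longrightarrow> progress P S i t < v"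
proof -
  have cont: "continuous_on {0..t} (progress P S i)"
    unfolding progress_def
    using exec_rate_seq_integrable_on [OF reg] by (intro indefinite_integral_continuous_1) auto
  have "compact ({0..t} \<inter> progress P S i -` {v})"
    using continuous_closed_preimage [OF cont] by (simp add: compact_eq_bounded_closed bounded_Int)
  moreover have "{0..t} \<inter> progress P S i -` {v} \<noteq> {}"
    using IVT' [of "progress P S i" 0 v t, OF _ _ _ cont] assms by auto
  ultimately obtain h where h: "h \<in> {0..t} \<inter> progress P S i -` {v}"
    and least: "\<And>s. s \<in> {0..t} \<inter> progress P S i -` {v} \<Longrightarrow> h \<le> s"
    by (metis compact_attains_inf)
  have "progress P S i s < v" if "0 \<le> s" "s < h" for s
  proof -
    have "progress P S i s \<le> v"
      using progress_mono [OF reg, of s h i] that h by auto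
    moreover have "progress P S i s \<noteq> v" using least [of s] that h by auto
    ultimately show ?thesis by simp
  qed
  then show thesis using that [of h] h by auto
qed

text \<open>Agreement strictly before \<open>t\<close> suffices because the endpoint is a null set.
  This allows runs to be compared at the very moment when they might start to differ.\<close>

lemma progress_cong:
  assumes "\<And>s p. 0 \<le> s \<Longrightarrow> s < t \<Longrightarrow> p < P \<Longrightarrow>
    alloc S s p = alloc S' s p \<and> speed S s p = speed S' s p"
  shows "progress P S i t = progress P S' i t"
  unfolding progress_def
proof (rule integral_spike [of "{t}"])
  show "exec_rate P S' i 1 s = exec_rate P S i 1 s" if "s \<in> {0..t} - {t}" for s
    using that assms by (intro exec_rate_cong) auto
qed auto

section \<open>Sets of single-phase sequential jobs\<close>

definition seq_jobs :: "nat \<Rightarrow> (nat \<Rightarrow> real) \<Rightarrow> jobset" where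
  "seq_jobs P w = map (\<lambda>i. \<lparr>release = 0, phases = [\<lparr>work = w i, par = 1\<rparr>]\<rparr>) [0..<P]"

lemma length_seq_jobs [simp]: "length (seq_jobs P w) = P"
  by (simp add: seq_jobs_def)

lemma nth_seq_jobs [simp]:
  "i < P \<Longrightarrow> seq_jobs P w ! i = \<lparr>release = 0, phases = [\<lparr>work = w i, par = 1\<rparr>]\<rparr>"
  by (simp add: seq_jobs_def)

lemma valid_jobset_seq_jobs:
  assumes "P > 0" "\<And>i. i < P \<Longrightarrow> 0 < w i"
  shows "valid_jobset (seq_jobs P w)"
  using assms by (auto simp: valid_jobset_def seq_jobs_def)

section \<open>Completion times in terms of progress\<close>

lemma completion_seq_jobs:
  assumes "regular_schedule P S" "i < P"
  shows "completion P (seq_jobs P w) S i = Inf {ereal t | t. 0 \<le> t \<and> w i \<le> progress P S i t}"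
proof -
  have "ennreal (w i) \<le> (\<integral>\<^sup>+\<tau>\<in>{\<tau>. 0 \<le> \<tau> \<and> \<tau> \<le> t}. ennreal (exec_rate P S i 1 \<tau>) \<partial>lborel) \<longleftrightarrow>
      w i \<le> progress P S i t" if "0 \<le> t" for t
    using exec_rate_seq_nn_integral [OF assms(1) order_refl that, of i]
      progress_nonneg [OF assms(1) that, of i]
    by (simp add: atLeastAtMost_def atLeast_def atMost_def Int_def ennreal_le_iff)
  then have "{ereal t | t. 0 \<le> t \<and> ennreal (w i) \<le>
        (\<integral>\<^sup>+\<tau>\<in>{\<tau>. 0 \<le> \<tau> \<and> \<tau> \<le> t}. ennreal (exec_rate P S i 1 \<tau>) \<partial>lborel)} =
      {ereal t | t. 0 \<le> t \<and> w i \<le> progress P S i t}"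
    by blast
  then show ?thesis using assms(2) by (simp add: completion_def)
qed

lemma completion_seq_jobs_eqI:
  assumes reg: "regular_schedule P S" and "i < P" and h: "0 \<le> h" "progress P S i h = w i"
    and first: "\<And>t. 0 \<le> t \<Longrightarrow> t < h \<Longrightarrow> progress P S i t < w i"
  shows "completion P (seq_jobs P w) S i = ereal h"
  unfolding completion_seq_jobs [OF reg \<open>i < P\<close>]
proof (rule Inf_eqI)
  fix y assume "y \<in> {ereal t | t. 0 \<le> t \<and> w i \<le> progress P S i t}"
  then obtain t where t: "y = ereal t" "0 \<le> t" "w i \<le> progress P S i t" by auto
  then show "ereal h \<le> y" using first [of t] by (cases "t < h") auto
next
  fix y assume *: "\<And>i'. i' \<in> {ereal t | t. 0 \<le> t \<and> w i \<le> progress P S i t} \<Longrightarrow> y \<le> i'"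
  show "y \<le> ereal h" using h by (intro *) auto
qed

text \<open>A finite completion time means that the work is reached at some time; by continuity the
  infimum is attained at the first hit. Hence being unfinished is the same as lying strictly before
  \<open>C\<close>.\<close>

lemma valid_seq_jobs_completion:
  assumes valid: "valid_schedule P (seq_jobs P w) S" and "i < P" "0 < w i"
  obtains C where "completion P (seq_jobs P w) S i = ereal C" "0 \<le> C" "progress P S i C = w i"
    "\<And>t. 0 \<le> t \<Longrightarrow> progress P S i t < w i \<longleftrightarrow> t < C"
proof -
  have reg: "regular_schedule P S" using valid assms(2) by (intro valid_schedule_imp_regular) auto
  have "completion P (seq_jobs P w) S i < \<infinity>" using valid assms(2) by (auto simp: valid_schedule_def)
  then have "{ereal t | t. 0 \<le> t \<and> w i \<le> progress P S i t} \<noteq> {}"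
    unfolding completion_seq_jobs [OF reg \<open>i < P\<close>] by (metis Inf_empty top_ereal_def less_irrefl)
  then obtain t where "0 \<le> t" "w i \<le> progress P S i t" by auto
  from progress_first_hit [OF reg this \<open>0 < w i\<close>] obtain h where h: "0 \<le> h" "progress P S i h = w i"
    and first: "\<And>t. 0 \<le> t \<Longrightarrow> t < h \<Longrightarrow> progress P S i t < w i" by metis
  show thesis
  proof (rule that)
    show "completion P (seq_jobs P w) S i = ereal h"
      using reg \<open>i < P\<close> h first by (rule completion_seq_jobs_eqI)
    show "progress P S i t < w i \<longleftrightarrow> t < h" if "0 \<le> t" for t
      using first [OF that] progress_mono [OF reg \<open>0 \<le> h\<close>, of t i] h(2)
      by (cases "t < h") auto
  qed (use h in auto)
qed

section \<open>Active jobs and observations\<close>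

definition active :: "nat \<Rightarrow> (nat \<Rightarrow> real) \<Rightarrow> schedule \<Rightarrow> real \<Rightarrow> nat set" where
  "active P w S t = {i. i < P \<and> progress P S i t < w i}"

lemma finite_active [simp]: "finite (active P w S t)"
  by (simp add: active_def)

text \<open>All parallelisms are 1, so an observation reveals exactly which jobs are unfinished and
  nothing about their works.\<close>

lemma visible_seq_jobs:
  assumes valid: "valid_schedule P (seq_jobs P w) S" and pos: "\<And>i. i < P \<Longrightarrow> 0 < w i"
    and "0 \<le> t"
  shows "visible P (seq_jobs P w) S t = (\<lambda>i. (i, 1)) ` active P w S t"
proof -
  have "ereal t < completion P (seq_jobs P w) S i \<longleftrightarrow> progress P S i t < w i" if i: "i < P" for i
  proof -
    obtain C where "completion P (seq_jobs P w) S i = ereal C"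
      "\<And>t. 0 \<le> t \<Longrightarrow> progress P S i t < w i \<longleftrightarrow> t < C"
      using valid_seq_jobs_completion [OF valid i pos [OF i]] by metis
    then show ?thesis using \<open>0 \<le> t\<close> by simp
  qed
  then show ?thesis using \<open>0 \<le> t\<close>
    by (auto simp: visible_def active_def completion_def image_iff simp del: phase_start.simps(2)
       cong: conj_cong)
qed

text \<open>Job \<open>i\<close> is active precisely on the half-open interval from 0 to its
  completion time, so membership does not change immediately to the right of
  \<open>s\<close>.\<close>

lemma eventually_active_eq:
  assumes valid: "valid_schedule P (seq_jobs P w) S" and pos: "\<And>i. i < P \<Longrightarrow> 0 < w i"
    and "0 \<le> s"
  shows "\<forall>\<^sub>F t in at_right s. active P w S t = active P w S s"
proof -
  have "\<forall>\<^sub>F t in at_right s. progress P S i t < w i \<longleftrightarrow> progress P S i s < w i" if i: "i < P" for i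
  proof -
    obtain C where C: "\<And>t. 0 \<le> t \<Longrightarrow> progress P S i t < w i \<longleftrightarrow> t < C"
      using valid_seq_jobs_completion [OF valid i pos [OF i]] by metis
    show ?thesis
    proof (cases "s < C")
      case True
      then show ?thesis using C \<open>0 \<le> s\<close>
        by (auto simp: eventually_at_right_field intro!: exI [of _ C])
    next
      case False
      then show ?thesis using C \<open>0 \<le> s\<close>
        by (auto simp: eventually_at_right_field intro!: exI [of _ "s + 1"])
    qed
  qed
  then have "\<forall>\<^sub>F t in at_right s. \<forall>i\<in>{..<P}. progress P S i t < w i \<longleftrightarrow> progress P S i s < w i"
    by (intro eventually_ball_finite) auto
  then show ?thesis by eventually_elim (auto simp: active_def)
qed

text \<open>
  At the infimum \<open>s\<close> of the times at which the active sets differ, the two runs coincide before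
  \<open>s\<close>, hence have the same progress and the same active set at \<open>s\<close>; both active sets then stay
  constant for a while after \<open>s\<close>.
\<close>

lemma semi_clairvoyant_coincide:
  assumes sc: "semi_clairvoyant P A" and "P > 0"
    and pos: "\<And>i. i < P \<Longrightarrow> 0 < w i" and pos': "\<And>i. i < P \<Longrightarrow> 0 < w' i"
    and undetected: "\<And>i t. i < P \<Longrightarrow> w i \<noteq> w' i \<Longrightarrow> 0 \<le> t \<Longrightarrow> t < T \<Longrightarrow>
      progress P (A (seq_jobs P w)) i t < min (w i) (w' i)"
    and "0 \<le> t" "t \<le> T"
  shows "progress P (A (seq_jobs P w)) i t = progress P (A (seq_jobs P w')) i t"
proof -
  let ?J = "seq_jobs P w" and ?J' = "seq_jobs P w'"
  define S where "S = A ?J"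
  define S' where "S' = A ?J'"
  have vJ: "valid_jobset ?J" "valid_jobset ?J'"
    using \<open>P > 0\<close> pos pos' by (auto intro!: valid_jobset_seq_jobs)
  then have valid: "valid_schedule P ?J S" "valid_schedule P ?J' S'"
    using sc by (auto simp: semi_clairvoyant_def S_def S'_def)
  have same_progress: "progress P S i r = progress P S' i r"
    if "\<And>s. 0 \<le> s \<Longrightarrow> s < r \<Longrightarrow> active P w S s = active P w' S' s" for i r
  proof (rule progress_cong)
    fix s p assume s: "0 \<le> s" "s < r" "p < P"
    have "visible P ?J S \<tau> = visible P ?J' S' \<tau>" if "\<tau> \<in> {0..s}" for \<tau>
      using that s \<open>\<And>s. 0 \<le> s \<Longrightarrow> s < r \<Longrightarrow> active P w S s = active P w' S' s\<close> [of \<tau>]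
      by (simp add: visible_seq_jobs [OF valid(1) pos] visible_seq_jobs [OF valid(2) pos'])
    then show "alloc S s p = alloc S' s p \<and> speed S s p = speed S' s p"
      using sc vJ s unfolding semi_clairvoyant_def S_def S'_def by blast
  qed
  have same_active: "active P w S s = active P w' S' s" if "0 \<le> s" "s < T" for s
  proof (rule ccontr)
    assume ne: "active P w S s \<noteq> active P w' S' s"
    define D where "D = {s. 0 \<le> s \<and> s < T \<and> active P w S s \<noteq> active P w' S' s}"
    have "s \<in> D" using ne that by (auto simp: D_def)
    have bdd: "bdd_below D" by (auto simp: D_def intro!: bdd_belowI [of _ 0])
    define m where "m = Inf D"
    have m_le: "m \<le> s" if "s \<in> D" for s using bdd that by (auto simp: m_def intro!: cInf_lower)
    have m: "0 \<le> m" "m < T"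
      using \<open>s \<in> D\<close> m_le [OF \<open>s \<in> D\<close>] by (auto simp: m_def D_def intro!: cInf_greatest)
    have "progress P S i m = progress P S' i m" for i
    proof (rule same_progress)
      fix r assume "0 \<le> r" "r < m"
      then show "active P w S r = active P w' S' r" using m_le [of r] m by (force simp: D_def)
    qed
    \<comment> \<open>A job with equal works has equal status because progress agrees. A job with
      different works is active in both runs, as its progress is below both works before
      \<open>T\<close>.\<close>
    then have eq: "active P w S m = active P w' S' m"
      using undetected [of _ m] m unfolding active_def S_def [symmetric]
      by (intro Collect_cong conj_cong refl) (metis min_less_iff_conj)
    have "\<forall>\<^sub>F t in at_right m. active P w S t = active P w' S' t"
      using eventually_conj [OF eventually_active_eq [OF valid(1) pos m(1)]
          eventually_active_eq [OF valid(2) pos' m(1)]]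
      by (rule eventually_mono) (use eq in auto)
    then obtain b where b: "b > m" "\<And>t. m < t \<Longrightarrow> t < b \<Longrightarrow> active P w S t = active P w' S' t"
      by (auto simp: eventually_at_right_field)
    have "b \<le> r" if "r \<in> D" for r
    proof (rule ccontr)
      assume "\<not> b \<le> r"
      with m_le [OF that] have "r = m \<or> m < r \<and> r < b" by auto
      then show False using that eq b by (auto simp: D_def)
    qed
    then have "b \<le> m" using \<open>s \<in> D\<close> by (auto simp: m_def intro!: cInf_greatest)
    with b show False by simp
  qed
  show ?thesis
    using same_progress [of t i] same_active \<open>t \<le> T\<close> by (auto simp: S_def S'_def)
qed


section \<open>The adversary\<close>

text \<open>
  After stage \<open>k\<close> the works of the \<open>k\<close> jobs in \<open>D\<close> are final and these jobs are complete at time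
  \<open>T\<close>; the others still have the provisional work 1, the largest that is ever assigned.
\<close>

definition adversary_state ::
    "nat \<Rightarrow> real \<Rightarrow> (jobset \<Rightarrow> schedule) \<Rightarrow> nat \<Rightarrow> nat set \<Rightarrow> (nat \<Rightarrow> real) \<Rightarrow> real \<Rightarrow> bool" where
  "adversary_state P \<alpha> A k D w T \<longleftrightarrow>
    D \<subseteq> {..<P} \<and> card D = k \<and> (\<forall>i<P. 0 < w i) \<and> (\<forall>i<P. i \<notin> D \<longrightarrow> w i = 1) \<and>
    (\<Sum>d\<in>D. w d powr \<alpha>) = (\<Sum>m<k. 1 / real (P - m)) \<and> 0 \<le> T \<and>
    (\<forall>d\<in>D. w d \<le> progress P (A (seq_jobs P w)) d T) \<and>
    (\<forall>j<P. j \<notin> D \<longrightarrow> progress P (A (seq_jobs P w)) j T < real (P - k) powr (- 1 / \<alpha>)) \<and>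
    (\<forall>t\<in>{0..T}. \<forall>j\<in>active P w (A (seq_jobs P w)) t.
      real (card (active P w (A (seq_jobs P w)) t)) * progress P (A (seq_jobs P w)) j t powr \<alpha> \<le> 1)"

text \<open>Induction on the number of decided jobs. The next job decided is the undecided job
  \<open>e\<close> that first reaches the threshold \<open>v\<close>; its work is lowered from 1 to
  \<open>v\<close>. The run up to that moment is unaffected, since neither work has been exhausted
  earlier.\<close>

lemma adversary_state_exists:
  fixes \<alpha> :: real
  assumes sc: "semi_clairvoyant P A" and "P > 0" and \<alpha>: "\<alpha> > 0" and "k \<le> P"
  shows "\<exists>D w T. adversary_state P \<alpha> A k D w T"
  using \<open>k \<le> P\<close>
proof (induction k)
  case 0
  have "adversary_state P \<alpha> A 0 {} (\<lambda>_. 1) 0"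
    using \<open>P > 0\<close> by (auto simp: adversary_state_def)
  then show ?case by blast
next
  case (Suc k)
  then obtain D w T where "adversary_state P \<alpha> A k D w T" by auto
  then have D: "D \<subseteq> {..<P}" "card D = k"
    and pos: "\<And>i. i < P \<Longrightarrow> 0 < w i" and undecided: "\<And>i. i < P \<Longrightarrow> i \<notin> D \<Longrightarrow> w i = 1"
    and total: "(\<Sum>d\<in>D. w d powr \<alpha>) = (\<Sum>m<k. 1 / real (P - m))"
    and T: "0 \<le> T" and finished: "\<And>d. d \<in> D \<Longrightarrow> w d \<le> progress P (A (seq_jobs P w)) d T"
    and behind: "\<And>j. j < P \<Longrightarrow> j \<notin> D \<Longrightarrow>
      progress P (A (seq_jobs P w)) j T < real (P - k) powr (- 1 / \<alpha>)"
    and bounded: "\<And>t j. t \<in> {0..T} \<Longrightarrow> j \<in> active P w (A (seq_jobs P w)) t \<Longrightarrow>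
      real (card (active P w (A (seq_jobs P w)) t)) * progress P (A (seq_jobs P w)) j t powr \<alpha> \<le> 1"
    unfolding adversary_state_def by blast+
  define S where "S = A (seq_jobs P w)"
  define v where "v = real (P - k) powr (- 1 / \<alpha>)"
  have "k < P" using Suc.prems by simp
  then have "0 < v" by (simp add: v_def)
  have v_powr: "v powr \<alpha> = 1 / real (P - k)"
  proof -
    have "v powr \<alpha> = real (P - k) powr - 1" using \<alpha> unfolding v_def powr_powr by simp
    then show ?thesis using \<open>k < P\<close> by (simp add: powr_minus_divide)
  qed
  have "v \<le> 1"
  proof -
    have "1 \<le> real (P - k) powr (1 / \<alpha>)"
      using \<alpha> \<open>k < P\<close> by (intro ge_one_powr_ge_zero) auto
    then show ?thesis using \<open>k < P\<close> by (simp add: v_def powr_minus_divide)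
  qed
  note v = \<open>0 < v\<close> \<open>v \<le> 1\<close>
  have valid: "valid_schedule P (seq_jobs P w) S"
    using sc valid_jobset_seq_jobs [of P w] \<open>P > 0\<close> pos
    by (auto simp: semi_clairvoyant_def S_def)
  have reg: "regular_schedule P S" using valid \<open>P > 0\<close> by (rule valid_schedule_imp_regular)
  define R where "R = {..<P} - D"
  have R: "finite R" "card R = P - k"
    using D by (auto simp: R_def card_Diff_subset finite_subset)
  then have "R \<noteq> {}" using \<open>k < P\<close> by auto
  \<comment> \<open>Under the provisional work 1 every undecided job must eventually complete, so it
    passes the level \<open>v\<close>, which is at most 1.\<close>
  have "\<exists>h. 0 \<le> h \<and> progress P S j h = v \<and> (\<forall>t. 0 \<le> t \<longrightarrow> t < h \<longrightarrow> progress P S j t < v)"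
    if j: "j \<in> R" for j
  proof -
    have "j < P" "w j = 1" using j undecided by (auto simp: R_def)
    then obtain C where "0 \<le> C" "progress P S j C = 1"
      using valid_seq_jobs_completion [OF valid, of j] by auto
    then show ?thesis using progress_first_hit [OF reg, of C v j] v by metis
  qed
  then obtain h where h: "\<And>j. j \<in> R \<Longrightarrow> 0 \<le> h j" "\<And>j. j \<in> R \<Longrightarrow> progress P S j (h j) = v"
    "\<And>j t. j \<in> R \<Longrightarrow> 0 \<le> t \<Longrightarrow> t < h j \<Longrightarrow> progress P S j t < v" by metis
  obtain e where e: "e \<in> R" "\<And>j. j \<in> R \<Longrightarrow> h e \<le> h j"
    using ex_is_arg_min_if_finite [OF R(1) \<open>R \<noteq> {}\<close>, of h] by (auto simp: is_arg_min_linorder)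
  have "e < P" "e \<notin> D" using e by (auto simp: R_def)
  define T' where "T' = h e"
  have T': "0 \<le> T'" using h e by (auto simp: T'_def)
  have before: "progress P S j t < v" if "j \<in> R" "0 \<le> t" "t < T'" for j t
    using that e(2) [of j] h(3) [of j t] by (auto simp: T'_def)
  \<comment> \<open>Only a weak inequality holds at \<open>T'\<close>, since several jobs may reach
    \<open>v\<close> simultaneously.\<close>
  have at: "progress P S j t \<le> v" if "j \<in> R" "0 \<le> t" "t \<le> T'" for j t
    using that progress_mono [OF reg, of t "h j" j] h(2) [of j] e(2) [of j] by (auto simp: T'_def)
  have "T < T'"
    using behind [OF \<open>e < P\<close> \<open>e \<notin> D\<close>] h(2) [OF e(1)] progress_mono [OF reg T', of T e]
    by (force simp: T'_def S_def v_def)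
  define w' where "w' = w(e := v)"
  have pos': "0 < w' i" if "i < P" for i using pos that v by (auto simp: w'_def)
  define S' where "S' = A (seq_jobs P w')"
  \<comment> \<open>Only the work of \<open>e\<close> has changed, and before \<open>T'\<close> its
    progress is below \<open>v\<close>, the smaller of the two works.\<close>
  have same: "progress P S' i t = progress P S i t" if "0 \<le> t" "t \<le> T'" for i t
    unfolding S_def S'_def
  proof (rule sym, rule semi_clairvoyant_coincide [where T = T'])
    show "progress P (A (seq_jobs P w)) i t < min (w i) (w' i)"
      if "w i \<noteq> w' i" "0 \<le> t" "t < T'" for i t
    proof -
      have "i = e" using that by (auto simp: w'_def split: if_splits)
      then show ?thesis
        using before [of e t] that e undecided [OF \<open>e < P\<close> \<open>e \<notin> D\<close>] v
        by (auto simp: w'_def S_def)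
    qed
  qed (use sc \<open>P > 0\<close> pos pos' that in auto)
  have w'_D: "w' d = w d" if "d \<in> D" for d using that \<open>e \<notin> D\<close> by (auto simp: w'_def)
  have finD: "finite D" using D by (auto intro: finite_subset)
  have total': "(\<Sum>d\<in>insert e D. w' d powr \<alpha>) = (\<Sum>m<Suc k. 1 / real (P - m))"
  proof -
    have "(\<Sum>d\<in>D. w' d powr \<alpha>) = (\<Sum>d\<in>D. w d powr \<alpha>)" by (simp add: w'_D)
    moreover have "w' e = v" by (simp add: w'_def)
    ultimately show ?thesis using total \<open>e \<notin> D\<close> finD v_powr by simp
  qed
  have finished': "w' d \<le> progress P S' d T'" if "d \<in> insert e D" for d
  proof (cases "d = e")
    case True
    then show ?thesis using h(2) [OF e(1)] T' by (simp add: same w'_def T'_def)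
  next
    case False
    then have "w d \<le> progress P S d T" using that finished by (auto simp: S_def)
    also have "\<dots> \<le> progress P S d T'" using \<open>T < T'\<close> T by (intro progress_mono reg) auto
    finally show ?thesis using False that T' by (auto simp: same w'_def)
  qed
  have behind': "progress P S' j T' < real (P - Suc k) powr (- 1 / \<alpha>)"
    if "j < P" "j \<notin> insert e D" for j
  proof -
    have "j \<in> R" using that by (auto simp: R_def)
    \<comment> \<open>Two undecided jobs \<open>e\<close> and \<open>j\<close> force
      \<open>Suc k < P\<close>; the next threshold is then a negative power of a positive number and
      strictly exceeds \<open>v\<close>.\<close>
    have "card {e, j} \<le> card R"
      using \<open>j \<in> R\<close> e R by (intro card_mono) auto
    then have "Suc k < P" using that R by auto
    then have "v < real (P - Suc k) powr (- 1 / \<alpha>)"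
      using \<alpha> unfolding v_def by (intro powr_less_mono2_neg) auto
    then show ?thesis using at [OF \<open>j \<in> R\<close> T' order_refl] T' by (simp add: same)
  qed
  \<comment> \<open>Up to \<open>T\<close> the job \<open>e\<close> is active under either work, so
    the old bound carries over. After \<open>T\<close> all jobs of \<open>D\<close> are finished,
    leaving at most \<open>P - k\<close> active jobs with progress at most \<open>v\<close>, and
    \<open>(P - k) * v powr \<alpha> = 1\<close>.\<close>
  have bounded': "real (card (active P w' S' t)) * progress P S' j t powr \<alpha> \<le> 1"
    if t: "t \<in> {0..T'}" and j: "j \<in> active P w' S' t" for t j
  proof (cases "t \<le> T")
    case True
    have "progress P S e t < v" using before [OF e(1), of t] True \<open>T < T'\<close> t by auto
    then have "active P w' S' t = active P w S t"
      using same [of t] t v undecided [OF \<open>e < P\<close> \<open>e \<notin> D\<close>]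
      by (auto simp: active_def w'_def split: if_splits)
    then show ?thesis using bounded [of t j] True t j same [of t j] by (simp add: S_def)
  next
    case False
    have sub: "active P w' S' t \<subseteq> R"
    proof
      fix i assume i: "i \<in> active P w' S' t"
      have "i \<notin> D"
      proof
        assume "i \<in> D"
        then have "w' i \<le> progress P S i T" using finished [of i] w'_D by (auto simp: S_def)
        also have "\<dots> \<le> progress P S i t" using False T by (intro progress_mono reg) auto
        also have "\<dots> = progress P S' i t" using same t by auto
        finally show False using i by (auto simp: active_def)
      qed
      then show "i \<in> R" using i by (auto simp: active_def R_def)
    qed
    then have "card (active P w' S' t) \<le> P - k" using card_mono [OF R(1) sub] R by simp
    moreover have "progress P S' j t powr \<alpha> \<le> v powr \<alpha>"
      using at [of j t] j sub t same [of t j] progress_nonneg [OF reg, of t j] \<alpha>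
      by (intro powr_mono2) auto
    ultimately have "real (card (active P w' S' t)) * progress P S' j t powr \<alpha> \<le>
        real (P - k) * v powr \<alpha>"
      by (intro mult_mono) auto
    also have "\<dots> = 1" using v_powr \<open>k < P\<close> by simp
    finally show ?thesis .
  qed
  have "insert e D \<subseteq> {..<P}" "card (insert e D) = Suc k"
    using D \<open>e < P\<close> \<open>e \<notin> D\<close> finD by auto
  moreover have "w' i = 1" if "i < P" "i \<notin> insert e D" for i
    using that undecided by (auto simp: w'_def)
  ultimately have "adversary_state P \<alpha> A (Suc k) (insert e D) w' T'"
    using pos' total' T' finished' behind' bounded' unfolding adversary_state_def S'_def by blast
  then show ?case by blast
qed

text \<open>After stage \<open>P\<close> every work is final and all jobs are complete at
  \<open>T\<close>, so the bound is vacuous beyond \<open>T\<close>. The decided works sum to the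
  harmonic number read backwards.\<close>

lemma adversary:
  fixes \<alpha> :: real
  assumes sc: "semi_clairvoyant P A" and "P > 0" and \<alpha>: "\<alpha> > 0"
  obtains w where "\<And>i. i < P \<Longrightarrow> 0 < w i" "(\<Sum>i<P. w i powr \<alpha>) = harm P"
    "\<And>t j. 0 \<le> t \<Longrightarrow> j \<in> active P w (A (seq_jobs P w)) t \<Longrightarrow>
      real (card (active P w (A (seq_jobs P w)) t)) * progress P (A (seq_jobs P w)) j t powr \<alpha> \<le> 1"
proof -
  obtain D w T where "adversary_state P \<alpha> A P D w T"
    using adversary_state_exists [OF sc \<open>P > 0\<close> \<alpha> order_refl] by blast
  then have D: "D \<subseteq> {..<P}" "card D = P" and pos: "\<And>i. i < P \<Longrightarrow> 0 < w i"
    and total: "(\<Sum>d\<in>D. w d powr \<alpha>) = (\<Sum>m<P. 1 / real (P - m))" and "0 \<le> T"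
    and finished: "\<And>d. d \<in> D \<Longrightarrow> w d \<le> progress P (A (seq_jobs P w)) d T"
    and bounded: "\<And>t j. t \<in> {0..T} \<Longrightarrow> j \<in> active P w (A (seq_jobs P w)) t \<Longrightarrow>
      real (card (active P w (A (seq_jobs P w)) t)) * progress P (A (seq_jobs P w)) j t powr \<alpha> \<le> 1"
    unfolding adversary_state_def by blast+
  have "D = {..<P}" using D by (intro card_subset_eq) auto
  have "valid_schedule P (seq_jobs P w) (A (seq_jobs P w))"
    using sc valid_jobset_seq_jobs [of P w] \<open>P > 0\<close> pos by (auto simp: semi_clairvoyant_def)
  then have reg: "regular_schedule P (A (seq_jobs P w))"
    using \<open>P > 0\<close> by (rule valid_schedule_imp_regular)
  show thesis
  proof (rule that [of w])
    have "(\<Sum>m<P. 1 / real (P - m)) = (\<Sum>m<P. inverse (real (Suc (P - Suc m))))"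
      by (intro sum.cong) (auto simp: field_simps Suc_diff_Suc)
    also have "\<dots> = harm P"
      by (subst sum.nat_diff_reindex) (simp add: harm_altdef)
    finally show "(\<Sum>i<P. w i powr \<alpha>) = harm P" using total \<open>D = {..<P}\<close> by simp
  next
    fix t j assume t: "0 \<le> t" and j: "j \<in> active P w (A (seq_jobs P w)) t"
    have "t \<le> T"
    proof (rule ccontr)
      assume "\<not> t \<le> T"
      then have "progress P (A (seq_jobs P w)) j T \<le> progress P (A (seq_jobs P w)) j t"
        using \<open>0 \<le> T\<close> by (intro progress_mono reg) auto
      then show False using j finished [of j] \<open>D = {..<P}\<close> by (auto simp: active_def)
    qed
    then show "real (card (active P w (A (seq_jobs P w)) t)) *
        progress P (A (seq_jobs P w)) j t powr \<alpha> \<le> 1"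
      using bounded t j by auto
  qed (use pos in auto)
qed

section \<open>The cost of the algorithm\<close>

text \<open>A crude form of Young's inequality: replacing both factors by the maximum of
  \<open>a\<close> and \<open>b\<close> gives one of the two powers.\<close>

lemma mult_powr_le_add_powr:
  fixes a b \<alpha> :: real
  assumes "0 \<le> a" "0 \<le> b" "1 < \<alpha>"
  shows "a * b powr (\<alpha> - 1) \<le> a powr \<alpha> + b powr \<alpha>"
proof -
  have split: "x powr \<alpha> = x * x powr (\<alpha> - 1)" if "0 \<le> x" for x :: real
    using that powr_mult_base [of x "\<alpha> - 1"] by simp
  have "a * b powr (\<alpha> - 1) \<le> max a b * max a b powr (\<alpha> - 1)"
    using assms by (intro mult_mono powr_mono2) auto
  also have "\<dots> = max a b powr \<alpha>" using assms by (simp add: split)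
  also have "\<dots> \<le> a powr \<alpha> + b powr \<alpha>" by (auto simp: max_def)
  finally show ?thesis .
qed

text \<open>Job \<open>i\<close> is charged at rate \<open>b i powr (\<alpha> - 1)\<close> per unit
  of work in the second half of its work, \<open>b i powr \<alpha>\<close> in total. At almost every
  time the combined charge is at most 1 plus the power, and integration up to the makespan gives the
  cost.\<close>

lemma cost_seq_jobs_lower:
  fixes \<alpha> :: real
  assumes valid: "valid_schedule P (seq_jobs P w) S" and "P > 0" and \<alpha>: "1 < \<alpha>"
    and pos: "\<And>i. i < P \<Longrightarrow> 0 < w i"
    and bounded: "\<And>t j. 0 \<le> t \<Longrightarrow> j \<in> active P w S t \<Longrightarrow>
      real (card (active P w S t)) * progress P S j t powr \<alpha> \<le> 1"
  shows "ennreal ((1 / 2) powr \<alpha> * (\<Sum>i<P. w i powr \<alpha>)) \<le> cost \<alpha> P (seq_jobs P w) S"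
proof -
  have reg: "regular_schedule P S" using valid \<open>P > 0\<close> by (rule valid_schedule_imp_regular)
  have "\<exists>C. completion P (seq_jobs P w) S i = ereal C \<and> 0 \<le> C \<and> progress P S i C = w i \<and>
      (\<forall>t\<ge>0. progress P S i t < w i \<longleftrightarrow> t < C)" if "i < P" for i
    using valid_seq_jobs_completion [OF valid that pos [OF that]] by metis
  then obtain C where C: "\<And>i. i < P \<Longrightarrow> completion P (seq_jobs P w) S i = ereal (C i)"
    "\<And>i. i < P \<Longrightarrow> 0 \<le> C i" "\<And>i. i < P \<Longrightarrow> progress P S i (C i) = w i"
    "\<And>i t. i < P \<Longrightarrow> 0 \<le> t \<Longrightarrow> progress P S i t < w i \<longleftrightarrow> t < C i" by metis
  have "\<exists>h. 0 \<le> h \<and> h \<le> C i \<and> progress P S i h = w i / 2" if "i < P" for i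
    using progress_first_hit [OF reg C(2) [OF that], of "w i / 2" i] C(3) [OF that] pos [OF that]
    by (metis field_sum_of_halves half_gt_zero le_add_same_cancel1 less_imp_le)
  then obtain h where h: "\<And>i. i < P \<Longrightarrow> 0 \<le> h i" "\<And>i. i < P \<Longrightarrow> h i \<le> C i"
    "\<And>i. i < P \<Longrightarrow> progress P S i (h i) = w i / 2" by metis
  define M where "M = makespan P (seq_jobs P w) S"
  have "M = Max (C ` {..<P})"
    using C(1) by (auto simp: M_def makespan_def intro!: arg_cong [where f = Max])
  then have C_le: "C i \<le> M" if "i < P" for i using that by auto
  have "0 \<le> M" using C_le [OF \<open>P > 0\<close>] C(2) [OF \<open>P > 0\<close>] by simp
  \<comment> \<open>Half the work plays two roles: it is the work done between \<open>h i\<close>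
    and \<open>C i\<close>, and a lower bound on the progress throughout that interval.\<close>
  define b where "b i = w i / 2" for i
  define u where "u t = (\<Sum>p<P. speed S t p powr \<alpha>)" for t
  define f where "f i t = ennreal (exec_rate P S i 1 t) * indicator {h i..C i} t" for i t
  have f_meas: "f i \<in> borel_measurable lborel" if "i < P" for i
  proof -
    have "set_integrable lborel {h i..C i} (exec_rate P S i 1)"
      by (rule set_integrable_subset [OF exec_rate_seq_set_integrable [OF reg, of "C i"]])
        (use h(1) [OF that] in auto)
    then have "(\<lambda>t. ennreal (indicator {h i..C i} t *\<^sub>R exec_rate P S i 1 t)) \<in> borel_measurable lborel"
      unfolding set_integrable_def
      by (rule measurable_compose [OF borel_measurable_integrable measurable_ennreal])
    also have "(\<lambda>t. ennreal (indicator {h i..C i} t *\<^sub>R exec_rate P S i 1 t)) = f i"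
      by (auto simp: f_def fun_eq_iff indicator_def)
    finally show ?thesis .
  qed
  have f_int: "integral\<^sup>N lborel (f i) = ennreal (b i)" if "i < P" for i
    unfolding f_def using exec_rate_seq_nn_integral [OF reg h(1,2) [OF that], of i] that
    by (simp add: C(3) h(3) b_def)
  \<comment> \<open>The cut-off at \<open>M\<close> is essential here because speeds are only given
    as integrable on bounded intervals starting at 0.\<close>
  have u_meas: "(\<lambda>t. ennreal (u t) * indicator {0..M} t) \<in> borel_measurable lborel"
  proof -
    have "(\<lambda>t. indicator {0..M} t *\<^sub>R speed S t p) \<in> borel_measurable lborel" if "p < P" for p
      using reg that unfolding regular_schedule_def set_integrable_def
      by (intro borel_measurable_integrable) blast
    then have "(\<lambda>t. ennreal (\<Sum>p<P. (indicator {0..M} t *\<^sub>R speed S t p) powr \<alpha>)) \<in> borel_measurable lborel"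
      by (intro measurable_compose [OF _ measurable_ennreal] borel_measurable_sum
        powr_real_measurable) auto
    also have "(\<lambda>t. ennreal (\<Sum>p<P. (indicator {0..M} t *\<^sub>R speed S t p) powr \<alpha>)) =
        (\<lambda>t. ennreal (u t) * indicator {0..M} t)"
      by (auto simp: u_def fun_eq_iff indicator_def)
    finally show ?thesis .
  qed
  \<comment> \<open>Completion times are excluded because \<open>f i\<close> still counts the
    endpoint \<open>C i\<close>, where job \<open>i\<close> is no longer active. They form a finite,
    hence null, set.\<close>
  have pointwise: "(\<Sum>i<P. ennreal (b i powr (\<alpha> - 1)) * f i t) \<le>
      indicator {0..M} t + ennreal (u t) * indicator {0..M} t" if t: "t \<notin> C ` {..<P}" for t
  proof -
    define I where "I = {i. i < P \<and> t \<in> {h i..C i}}"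
    have "finite I" by (simp add: I_def)
    have zero: "f i t = 0" if "i < P" "i \<notin> I" for i
      using that by (auto simp: f_def I_def indicator_def)
    show ?thesis
    proof (cases "I = {}")
      case True
      then show ?thesis using zero by simp
    next
      case False
      then have "0 \<le> t" "t \<le> M" using h(1) C_le by (force simp: I_def)+
      then have nn: "0 \<le> speed S t p" if "p < P" for p
        using reg that by (auto simp: regular_schedule_def)
      have r: "0 \<le> exec_rate P S i 1 t" for i using nn by (rule exec_rate_seq_nonneg)
      have I_active: "I \<subseteq> active P w S t"
      proof
        fix i assume "i \<in> I"
        then have "i < P" "t \<le> C i" by (auto simp: I_def)
        moreover from this have "t \<noteq> C i" using t by auto
        ultimately show "i \<in> active P w S t" using C(4) [of i t] \<open>0 \<le> t\<close> by (auto simp: active_def)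
      qed
      have n_pos: "card (active P w S t) > 0" using I_active False by (auto simp: card_gt_0_iff)
      have b_le: "b i powr \<alpha> \<le> 1 / real (card (active P w S t))" if "i \<in> I" for i
      proof -
        have i: "i < P" "h i \<le> t" using that by (auto simp: I_def)
        then have "b i \<le> progress P S i t"
          using progress_mono [OF reg h(1), of i t i] h(3) [of i] by (simp add: b_def)
        then have "b i powr \<alpha> \<le> progress P S i t powr \<alpha>"
          using pos [OF i(1)] \<alpha> by (intro powr_mono2) (auto simp: b_def)
        also have "\<dots> \<le> 1 / real (card (active P w S t))"
          using bounded [OF \<open>0 \<le> t\<close>, of i] that I_active n_pos by (auto simp: field_simps)
        finally show ?thesis .
      qed
      \<comment> \<open>Each term is at most the reciprocal of the number of active jobs, and
        \<open>I\<close> contains only active jobs. So these terms are paid for by elapsed time,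
        that is, by the makespan.\<close>
      have "(\<Sum>i\<in>I. b i powr \<alpha>) \<le> real (card I) * (1 / real (card (active P w S t)))"
        using sum_bounded_above [of I, OF b_le] by simp
      also have "\<dots> \<le> 1" using card_mono [OF finite_active I_active] n_pos by (simp add: field_simps)
      finally have b_sum: "(\<Sum>i\<in>I. b i powr \<alpha>) \<le> 1" .
      have "(\<Sum>i\<in>I. exec_rate P S i 1 t * b i powr (\<alpha> - 1)) \<le>
          (\<Sum>i\<in>I. exec_rate P S i 1 t powr \<alpha> + b i powr \<alpha>)"
        using \<alpha> r pos by (intro sum_mono mult_powr_le_add_powr) (auto simp: b_def I_def less_imp_le)
      also have "\<dots> \<le> 1 + u t"
        using b_sum sum_exec_rate_seq_powr_le [of P S t \<alpha> I] nn \<alpha> \<open>finite I\<close>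
        by (simp add: sum.distrib u_def)
      finally have main: "(\<Sum>i\<in>I. exec_rate P S i 1 t * b i powr (\<alpha> - 1)) \<le> 1 + u t" .
      have "(\<Sum>i<P. ennreal (b i powr (\<alpha> - 1)) * f i t) = (\<Sum>i\<in>I. ennreal (b i powr (\<alpha> - 1)) * f i t)"
        using zero by (intro sum.mono_neutral_right) (auto simp: I_def)
      also have "\<dots> = (\<Sum>i\<in>I. ennreal (exec_rate P S i 1 t * b i powr (\<alpha> - 1)))"
        using r by (intro sum.cong) (auto simp: f_def I_def ennreal_mult mult.commute)
      also have "\<dots> = ennreal (\<Sum>i\<in>I. exec_rate P S i 1 t * b i powr (\<alpha> - 1))"
        using r by (intro sum_ennreal) auto
      also have "\<dots> \<le> ennreal (1 + u t)" using main by (rule ennreal_leI)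
      also have "\<dots> = indicator {0..M} t + ennreal (u t) * indicator {0..M} t"
        using \<open>0 \<le> t\<close> \<open>t \<le> M\<close> by (simp add: ennreal_plus u_def sum_nonneg)
      finally show ?thesis .
    qed
  qed
  have b_powr: "b i powr (\<alpha> - 1) * b i = (1 / 2) powr \<alpha> * w i powr \<alpha>" if "i < P" for i
    using pos [OF that] powr_mult_base [of "b i" "\<alpha> - 1"] powr_mult [of "1 / 2" "w i" \<alpha>]
    by (simp add: b_def mult.commute)
  have "ennreal ((1 / 2) powr \<alpha> * (\<Sum>i<P. w i powr \<alpha>)) = ennreal (\<Sum>i<P. b i powr (\<alpha> - 1) * b i)"
    using b_powr by (simp add: sum_distrib_left)
  also have "\<dots> = (\<Sum>i<P. ennreal (b i powr (\<alpha> - 1) * b i))"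
    using pos by (intro sum_ennreal [symmetric]) (auto simp: b_def less_imp_le)
  also have "\<dots> = (\<Sum>i<P. \<integral>\<^sup>+t. ennreal (b i powr (\<alpha> - 1)) * f i t \<partial>lborel)"
  proof (intro sum.cong refl)
    fix i assume "i \<in> {..<P}"
    then have "i < P" "0 \<le> b i" using pos [of i] by (auto simp: b_def)
    then show "ennreal (b i powr (\<alpha> - 1) * b i) =
        (\<integral>\<^sup>+t. ennreal (b i powr (\<alpha> - 1)) * f i t \<partial>lborel)"
      using f_meas [of i] f_int [of i] by (simp add: nn_integral_cmult ennreal_mult)
  qed
  also have "\<dots> = (\<integral>\<^sup>+t. (\<Sum>i<P. ennreal (b i powr (\<alpha> - 1)) * f i t) \<partial>lborel)"
    using f_meas by (intro nn_integral_sum [symmetric]) auto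
  also have "\<dots> \<le> (\<integral>\<^sup>+t. indicator {0..M} t + ennreal (u t) * indicator {0..M} t \<partial>lborel)"
  proof (rule nn_integral_mono_AE)
    have "AE t in lborel. t \<notin> C ` {..<P}"
      by (intro AE_not_in finite_imp_null_set_lborel) auto
    then show "AE t in lborel. (\<Sum>i<P. ennreal (b i powr (\<alpha> - 1)) * f i t) \<le>
        indicator {0..M} t + ennreal (u t) * indicator {0..M} t"
      by eventually_elim (rule pointwise)
  qed
  also have "\<dots> = ennreal M + (\<integral>\<^sup>+t\<in>{0..M}. ennreal (u t) \<partial>lborel)"
    using u_meas \<open>0 \<le> M\<close> by (subst nn_integral_add) auto
  also have "\<dots> \<le> ennreal M + energy \<alpha> P S"
    unfolding energy_def u_def
    by (intro add_left_mono nn_integral_mono) (auto simp: indicator_def)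
  finally show ?thesis by (simp add: cost_def M_def)
qed


section \<open>The cost of an optimal schedule\<close>

text \<open>With \<open>P\<close> jobs and \<open>P\<close> processors each job has its own
  processor, and constant speeds finish all of them by \<open>T\<close>. The horizon
  \<open>T\<close> is left free so that makespan and energy can be balanced later.\<close>

lemma opt_cost_seq_jobs_le:
  fixes \<alpha> :: real
  assumes "P > 0" "0 < T" and pos: "\<And>i. i < P \<Longrightarrow> 0 < w i"
  shows "opt_cost \<alpha> P (seq_jobs P w) \<le> ennreal (T + (\<Sum>i<P. w i powr \<alpha>) * T powr (1 - \<alpha>))"
proof -
  \<comment> \<open>Processors stay assigned after \<open>T\<close>, but at speed 0, so they consume
    no energy.\<close>
  define S where "S = \<lparr>alloc = \<lambda>t p. Some p, speed = \<lambda>t p. if p < P \<and> t \<le> T then w p / T else 0\<rparr>"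
  have speed: "speed S t p = (if t \<le> T then w p / T else 0)" if "p < P" for t p
    using that by (simp add: S_def)
  have "set_integrable lborel {0..b} (\<lambda>t. speed S t p)" if "p < P" for p b
  proof -
    have "(\<lambda>t. indicator {0..b} t *\<^sub>R speed S t p) = (\<lambda>t. (w p / T) * indicator {0..min b T} t)"
      using speed [OF that] by (auto simp: fun_eq_iff indicator_def)
    moreover have "integrable lborel (\<lambda>t. (w p / T) * indicator {0..min b T} t)"
      by (intro integrable_mult_right integrable_real_indicator) (auto simp: emeasure_lborel_Icc_eq)
    ultimately show ?thesis unfolding set_integrable_def by simp
  qed
  then have reg: "regular_schedule P S"
    using assms by (auto simp: regular_schedule_def S_def less_imp_le)
  have rate: "exec_rate P S i 1 t = w i / T" if "i < P" "t \<le> T" for i t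
  proof -
    have "{p. p < P \<and> alloc S t p = Some i} = {i}" using that by (auto simp: S_def)
    then show ?thesis using that speed [of i t] by (simp add: exec_rate_seq_eq_Max Let_def)
  qed
  have progress: "progress P S i T = w i" if "i < P" for i
  proof -
    have "progress P S i T = integral {0..T} (\<lambda>_. w i / T)"
      unfolding progress_def using rate that
      by (intro Henstock_Kurzweil_Integration.integral_cong) auto
    then show ?thesis using \<open>0 < T\<close> by simp
  qed
  have compl: "completion P (seq_jobs P w) S i \<le> ereal T" "0 \<le> completion P (seq_jobs P w) S i"
    if "i < P" for i
    unfolding completion_seq_jobs [OF reg that]
    using progress [OF that] \<open>0 < T\<close> by (auto intro!: Inf_lower Inf_greatest)
  have valid: "valid_schedule P (seq_jobs P w) S"
    unfolding valid_schedule_def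
  proof (intro conjI)
    show "\<forall>i<length (seq_jobs P w). completion P (seq_jobs P w) S i < \<infinity>"
      using compl(1) by (metis length_seq_jobs ereal_infty_less(1) ereal_infty_less_eq(1) PInfty_neq_ereal(1))
  qed (use reg in \<open>auto simp: regular_schedule_def S_def\<close>)
  have "makespan P (seq_jobs P w) S \<le> T"
    unfolding makespan_def
  proof (rule Max.boundedI)
    fix c assume "c \<in> (\<lambda>i. real_of_ereal (completion P (seq_jobs P w) S i)) ` {..<length (seq_jobs P w)}"
    then obtain i where i: "i < P" "c = real_of_ereal (completion P (seq_jobs P w) S i)" by auto
    then show "c \<le> T"
      using compl [OF i(1)] by (cases "completion P (seq_jobs P w) S i") auto
  qed (use \<open>P > 0\<close> in auto)
  moreover have "energy \<alpha> P S = ennreal ((\<Sum>i<P. w i powr \<alpha>) * T powr (1 - \<alpha>))"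
  proof -
    have "energy \<alpha> P S = (\<integral>\<^sup>+t\<in>{0..T}. ennreal (\<Sum>p<P. (w p / T) powr \<alpha>) \<partial>lborel)"
      unfolding energy_def by (intro nn_integral_cong) (auto simp: speed indicator_def)
    also have "\<dots> = ennreal ((\<Sum>p<P. (w p / T) powr \<alpha>) * T)"
      using \<open>0 < T\<close> by (simp add: nn_integral_cmult ennreal_mult sum_nonneg)
    also have "(\<Sum>p<P. (w p / T) powr \<alpha>) * T = (\<Sum>p<P. w p powr \<alpha>) * T powr (1 - \<alpha>)"
      unfolding sum_distrib_right using pos \<open>0 < T\<close>
      by (intro sum.cong) (auto simp: powr_divide powr_diff less_imp_le)
    finally show ?thesis .
  qed
  ultimately have "cost \<alpha> P (seq_jobs P w) S \<le> ennreal (T + (\<Sum>i<P. w i powr \<alpha>) * T powr (1 - \<alpha>))"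
    unfolding cost_def using \<open>0 < T\<close>
    by (simp add: ennreal_plus sum_nonneg add_right_mono ennreal_leI)
  then show ?thesis
    unfolding opt_cost_def using valid by (intro INF_lower2 [of S]) auto
qed

theorem theorem11:
  fixes \<alpha> :: real
  assumes "1 < \<alpha>"
  shows "\<exists>c::real. 0 < c \<and>
    (\<forall>(P::nat) (A :: jobset \<Rightarrow> schedule). 2 \<le> P \<longrightarrow> semi_clairvoyant P A \<longrightarrow>
      (\<exists>J. valid_jobset J \<and>
        cost \<alpha> P J (A J) \<ge> ennreal (c * (ln (real P)) powr (1 - 1 / \<alpha>)) * opt_cost \<alpha> P J))"
proof (intro exI [of _ "(1 / 2) powr \<alpha> / 2"] conjI allI impI)
  fix P :: nat and A :: "jobset \<Rightarrow> schedule"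
  assume P: "2 \<le> P" and sc: "semi_clairvoyant P A"
  then have "P > 0" by simp
  obtain w where pos: "\<And>i. i < P \<Longrightarrow> 0 < w i" and total: "(\<Sum>i<P. w i powr \<alpha>) = harm P"
    and bounded: "\<And>t j. 0 \<le> t \<Longrightarrow> j \<in> active P w (A (seq_jobs P w)) t \<Longrightarrow>
      real (card (active P w (A (seq_jobs P w)) t)) * progress P (A (seq_jobs P w)) j t powr \<alpha> \<le> 1"
    using adversary [OF sc \<open>P > 0\<close>, of \<alpha>] assms by auto
  define J where "J = seq_jobs P w"
  \<comment> \<open>The constant of the theorem is \<open>c / 2\<close>: the factor \<open>c\<close>
    comes from counting only second halves of the works, and the 2 from the optimum bound, where
    makespan and energy contribute equally.\<close>
  define c where "c = (1 / 2 :: real) powr \<alpha>"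
  define H where "H = (harm P :: real)"
  define L where "L = ln (real P)"
  have "0 < H" using \<open>P > 0\<close> by (simp add: H_def harm_pos)
  have "0 \<le> L" using P by (simp add: L_def)
  have "L \<le> ln (real P + 1)" using P by (simp add: L_def)
  also have "\<dots> \<le> H" using ln_le_harm [of P] by (simp add: H_def)
  finally have "L \<le> H" .
  have vJ: "valid_jobset J" using \<open>P > 0\<close> pos by (auto simp: J_def intro: valid_jobset_seq_jobs)
  then have "valid_schedule P J (A J)" using sc by (auto simp: semi_clairvoyant_def)
  then have alg: "ennreal (c * H) \<le> cost \<alpha> P J (A J)"
    using cost_seq_jobs_lower [of P w "A J" \<alpha>] \<open>P > 0\<close> assms pos bounded total
    by (simp add: J_def c_def H_def)
  \<comment> \<open>With horizon \<open>H powr (1 / \<alpha>)\<close> the energy bound equals the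
    makespan bound.\<close>
  have balance: "H * (H powr (1 / \<alpha>)) powr (1 - \<alpha>) = H powr (1 / \<alpha>)"
  proof -
    have "(1 / \<alpha>) * (1 - \<alpha>) = 1 / \<alpha> - 1" using assms by (simp add: field_simps)
    then have "(H powr (1 / \<alpha>)) powr (1 - \<alpha>) = H powr (1 / \<alpha> - 1)" by (simp only: powr_powr)
    then show ?thesis using \<open>0 < H\<close> by (simp add: powr_diff)
  qed
  have opt: "opt_cost \<alpha> P J \<le> ennreal (2 * H powr (1 / \<alpha>))"
    using opt_cost_seq_jobs_le [of P "H powr (1 / \<alpha>)" w \<alpha>] \<open>P > 0\<close> \<open>0 < H\<close> pos
      total [folded H_def] balance
    by (simp add: J_def)
  have "ennreal (c / 2 * L powr (1 - 1 / \<alpha>)) * opt_cost \<alpha> P J \<le>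
      ennreal (c / 2 * L powr (1 - 1 / \<alpha>)) * ennreal (2 * H powr (1 / \<alpha>))"
    using opt by (rule mult_left_mono) simp
  also have "\<dots> = ennreal (c * (L powr (1 - 1 / \<alpha>) * H powr (1 / \<alpha>)))"
    by (simp add: ennreal_mult [symmetric] c_def mult.assoc)
  also have "\<dots> \<le> ennreal (c * H)"
  proof (intro ennreal_leI mult_left_mono)
    \<comment> \<open>The ratio obtained is of order \<open>H powr (1 - 1 / \<alpha>)\<close>;
      \<open>L \<le> H\<close> and the nonnegative exponent replace the harmonic number by the
      logarithm.\<close>
    have "L powr (1 - 1 / \<alpha>) * H powr (1 / \<alpha>) \<le> H powr (1 - 1 / \<alpha>) * H powr (1 / \<alpha>)"
      using \<open>0 \<le> L\<close> \<open>L \<le> H\<close> assms by (intro mult_right_mono powr_mono2) auto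
    also have "\<dots> = H" using \<open>0 < H\<close> by (simp add: powr_add [symmetric])
    finally show "L powr (1 - 1 / \<alpha>) * H powr (1 / \<alpha>) \<le> H" .
  qed (simp add: c_def)
  also note alg
  finally show "\<exists>J. valid_jobset J \<and>
      ennreal ((1 / 2) powr \<alpha> / 2 * ln (real P) powr (1 - 1 / \<alpha>)) * opt_cost \<alpha> P J \<le> cost \<alpha> P J (A J)"
    using vJ by (auto simp: c_def L_def)
qed simp

end
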